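(* Let $T$ be a finite rooted ordered tree with root $r$ and let $v_1,v_2\in T\setminus\{r\}$ with $v_1\le v_2$ in depth-first traversal order of $T$. Then there is a unique node $v\in T\setminus\{r\}$ such that $v_1\in T^*[v]$ and $v_2\in T[v]$.
   Context: Depth-first traversal order $<$ on $T$ is preorder (a node precedes its descendants; children are visited left to right). $T[v]$ denotes the subtree of $T$ consisting of $v$ and all its descendants in $T$; $T^*[v]$ denotes the analogous subtree of $v$ in the dual tree $T^*$. The dual $T^*$ has the same vertex set and root $r$; with $rmc_T(u)$ the rightmost child and $ils_T(u)$ the immediate left sibling of $u$ in $T$, parents and sibling order in $T^*$ are given by: (1a) $r$ has no parent in $T^*$; (1b) if $v=rmc_T(r)$ then $v$ is the rightmost child of $r$ in $T^*$; (2) if $v=rmc_T(u)$ with $u\ne r$, then $v$ is the immediate left sibling of $u$ in $T^*$; (3) if $v=ils_T(u)$, then $v$ is the rightmost child of $u$ in $T^*$. *)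

theory Defs
  imports Main
begin

text \<open>A finite rooted ordered tree is a rose tree whose labels are pairwise distinct; the
  vertices are the labels, and the children of a vertex are listed from left to right.\<close>

datatype (nodes: 'a) otree = Node (root: 'a) (children: "'a otree list")

primrec subtrees :: "'a otree \<Rightarrow> 'a otree set" where
  "subtrees (Node a ts) = insert (Node a ts) (\<Union> (set (map subtrees ts)))"

primrec preorder :: "'a otree \<Rightarrow> 'a list" where
  "preorder (Node a ts) = a # concat (map preorder ts)"

definition ordered_tree :: "'a otree \<Rightarrow> bool" where
  "ordered_tree T \<longleftrightarrow> distinct (preorder T)"

definition dft_le :: "'a otree \<Rightarrow> 'a \<Rightarrow> 'a \<Rightarrow> bool" where
  "dft_le T u v \<longleftrightarrow>
     (\<exists>i j. i \<le> j \<and> j < length (preorder T) \<and> preorder T ! i = u \<and> preorder T ! j = v)"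

text \<open>The vertex set of \<open>T[v]\<close>.\<close>

definition subtree_at :: "'a otree \<Rightarrow> 'a \<Rightarrow> 'a set" where
  "subtree_at T v = \<Union> {nodes S | S. S \<in> subtrees T \<and> root S = v}"

text \<open>\<open>is_rmc T u v\<close> means \<open>v = rmc_T(u)\<close>, and \<open>is_ils T u v\<close> means \<open>v = ils_T(u)\<close>;
  both are relations because a vertex may lack a rightmost child or an immediate left sibling.\<close>

definition is_rmc :: "'a otree \<Rightarrow> 'a \<Rightarrow> 'a \<Rightarrow> bool" where
  "is_rmc T u v \<longleftrightarrow> (\<exists>ts. Node u ts \<in> subtrees T \<and> ts \<noteq> [] \<and> v = root (last ts))"

definition is_ils :: "'a otree \<Rightarrow> 'a \<Rightarrow> 'a \<Rightarrow> bool" where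
  "is_ils T u v \<longleftrightarrow>
     (\<exists>a ts xs ys. Node a ts \<in> subtrees T \<and> map root ts = xs @ [v, u] @ ys)"

text \<open>\<open>is_dual T D\<close> means \<open>D = T\<^sup>*\<close>. The rule that \<open>r\<close> has no parent in \<open>T\<^sup>*\<close> is
  \<^term>\<open>root D = root T\<close>. The theorems \<open>ex1_dual\<close> and \<open>is_dual_iff\<close> below show that
  the rules determine exactly one tree.\<close>

definition is_dual :: "'a otree \<Rightarrow> 'a otree \<Rightarrow> bool" where
  "is_dual T D \<longleftrightarrow>
     ordered_tree D \<and> nodes D = nodes T \<and> root D = root T \<and>
     (\<forall>v. is_rmc T (root T) v \<longrightarrow> is_rmc D (root T) v) \<and>
     (\<forall>u v. u \<noteq> root T \<and> is_rmc T u v \<longrightarrow> is_ils D u v) \<and>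
     (\<forall>u v. is_ils T u v \<longrightarrow> is_rmc D u v)"


subsection \<open>Existence and uniqueness of the dual\<close>

lemma set_preorder: "set (preorder T) = nodes T"
  by (induction T) auto

function dual_forest :: "'a otree list \<Rightarrow> 'a otree list" where
  "dual_forest [] = []"
| "dual_forest (ts @ [Node v cs]) = dual_forest cs @ [Node v (dual_forest ts)]"
  by (metis otree.exhaust rev_exhaust) auto
termination
  by (relation "measure (size_list size)") auto

definition dual :: "'a otree \<Rightarrow> 'a otree" where
  "dual T = Node (root T) (dual_forest (children T))"

lemma forest_induct [case_names Nil snoc]:
  assumes "P []" and "\<And>ts v cs. P ts \<Longrightarrow> P cs \<Longrightarrow> P (ts @ [Node v cs])"
  shows "P ts"
  by (induction ts rule: dual_forest.induct) (use assms in auto)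

abbreviation fnodes :: "'a otree list \<Rightarrow> 'a set" where
  "fnodes F \<equiv> \<Union> (nodes ` set F)"

abbreviation fdistinct :: "'a otree list \<Rightarrow> bool" where
  "fdistinct F \<equiv> distinct (concat (map preorder F))"

lemma dual_forest_dual_forest: "dual_forest (dual_forest F) = F"
  by (induction F rule: forest_induct) auto

lemma fnodes_dual_forest: "fnodes (dual_forest F) = fnodes F"
  by (induction F rule: forest_induct) auto

lemma fdistinct_snoc:
  "fdistinct (ts @ [Node v cs]) \<longleftrightarrow> fdistinct ts \<and> fdistinct cs \<and>
     v \<notin> fnodes ts \<and> v \<notin> fnodes cs \<and> fnodes ts \<inter> fnodes cs = {}"
  by (auto simp: set_preorder)

lemma fdistinct_dual_forest: "fdistinct F \<Longrightarrow> fdistinct (dual_forest F)"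
proof (induction F rule: forest_induct)
  case (snoc ts v cs)
  then have "fdistinct (dual_forest ts)" "fdistinct (dual_forest cs)"
    and *: "v \<notin> fnodes ts" "v \<notin> fnodes cs" "fnodes ts \<inter> fnodes cs = {}"
    unfolding fdistinct_snoc by auto
  then show ?case
    unfolding dual_forest.simps fdistinct_snoc fnodes_dual_forest by blast
qed simp

lemma adjacent_snoc:
  "(\<exists>xs ys. L @ [w] = xs @ v # u # ys) \<longleftrightarrow>
     (L \<noteq> [] \<and> last L = v \<and> w = u) \<or> (\<exists>xs ys. L = xs @ v # u # ys)" (is "?l \<longleftrightarrow> ?r")
proof
  assume ?l
  then obtain xs ys where *: "L @ [w] = xs @ v # u # ys" by blast
  show ?r
  proof (cases ys rule: rev_cases)
    case Nil
    with * have "L @ [w] = (xs @ [v]) @ [u]" by simp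
    then show ?thesis unfolding append1_eq_conv by simp
  next
    case (snoc zs z)
    with * have "L @ [w] = (xs @ v # u # zs) @ [z]" by simp
    then show ?thesis unfolding append1_eq_conv by blast
  qed
next
  assume ?r
  then show ?l
  proof
    assume "L \<noteq> [] \<and> last L = v \<and> w = u"
    then have "L @ [w] = butlast L @ v # u # []"
      by (metis append_butlast_last_id append.assoc append_Cons append_Nil)
    then show ?l by blast
  next
    assume "\<exists>xs ys. L = xs @ v # u # ys"
    then show ?l by fastforce
  qed
qed

definition frmc :: "'a otree list \<Rightarrow> 'a \<Rightarrow> 'a \<Rightarrow> bool" where
  "frmc F u v \<longleftrightarrow> (\<exists>t\<in>set F. is_rmc t u v)"

definition fils :: "'a otree list \<Rightarrow> 'a \<Rightarrow> 'a \<Rightarrow> bool" where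
  "fils F u v \<longleftrightarrow> (\<exists>xs ys. map root F = xs @ v # u # ys) \<or> (\<exists>t\<in>set F. is_ils t u v)"

lemma is_rmc_Node:
  "is_rmc (Node a F) u v \<longleftrightarrow> (u = a \<and> F \<noteq> [] \<and> v = root (last F)) \<or> frmc F u v"
  unfolding is_rmc_def frmc_def by auto

lemma is_ils_Node: "is_ils (Node a F) u v \<longleftrightarrow> fils F u v"
  unfolding is_ils_def fils_def by auto

lemma frmc_Nil [simp]: "\<not> frmc [] u v" by (simp add: frmc_def)
lemma fils_Nil [simp]: "\<not> fils [] u v" by (simp add: fils_def)

lemma frmc_snoc:
  "frmc (ts @ [Node w cs]) u v \<longleftrightarrow>
     (u = w \<and> cs \<noteq> [] \<and> v = root (last cs)) \<or> frmc cs u v \<or> frmc ts u v"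
proof -
  have "frmc (ts @ [Node w cs]) u v \<longleftrightarrow> frmc ts u v \<or> is_rmc (Node w cs) u v"
    unfolding frmc_def by auto
  then show ?thesis unfolding is_rmc_Node by blast
qed

lemma fils_snoc:
  "fils (ts @ [Node w cs]) u v \<longleftrightarrow>
     (u = w \<and> ts \<noteq> [] \<and> v = root (last ts)) \<or> fils ts u v \<or> fils cs u v"
proof -
  have "fils (ts @ [Node w cs]) u v \<longleftrightarrow>
     (\<exists>xs ys. map root ts @ [w] = xs @ v # u # ys) \<or> (\<exists>t\<in>set ts. is_ils t u v) \<or> fils cs u v"
    unfolding fils_def[of "ts @ _"] by (auto simp: is_ils_Node)
  then show ?thesis
    unfolding adjacent_snoc fils_def[of ts] by (auto simp: last_map)
qed

lemma root_last_dual_forest: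
  "F \<noteq> [] \<Longrightarrow> dual_forest F \<noteq> [] \<and> root (last (dual_forest F)) = root (last F)"
  by (cases F rule: dual_forest.cases) auto

lemma dual_forest_Nil_iff: "dual_forest F = [] \<longleftrightarrow> F = []"
  by (cases F rule: dual_forest.cases) auto

lemma dual_forest_fils_frmc:
  "(fils (dual_forest F) u v \<longleftrightarrow> frmc F u v) \<and> (frmc (dual_forest F) u v \<longleftrightarrow> fils F u v)"
proof (induction F rule: forest_induct)
  case (snoc ts w cs)
  then show ?case
    unfolding dual_forest.simps frmc_snoc fils_snoc dual_forest_Nil_iff
    using root_last_dual_forest[of ts] root_last_dual_forest[of cs] by metis
qed simp

lemma frmc_in: "frmc F u v \<Longrightarrow> u \<in> fnodes F \<and> v \<in> fnodes F"
  and fils_in: "fils F u v \<Longrightarrow> u \<in> fnodes F \<and> v \<in> fnodes F"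
proof -
  have last: "ts \<noteq> [] \<Longrightarrow> root (last ts) \<in> fnodes ts" for ts :: "'a otree list"
    by (meson UN_iff last_in_set otree.set_sel(1))
  have "(frmc F u v \<longrightarrow> u \<in> fnodes F \<and> v \<in> fnodes F) \<and>
        (fils F u v \<longrightarrow> u \<in> fnodes F \<and> v \<in> fnodes F)"
  proof (induction F rule: forest_induct)
    case (snoc ts w cs)
    have eq: "fnodes (ts @ [Node w cs]) = insert w (fnodes ts \<union> fnodes cs)" by auto
    show ?case
      unfolding eq frmc_snoc fils_snoc using snoc last[of ts] last[of cs] by blast
  qed simp
  then show "frmc F u v \<Longrightarrow> u \<in> fnodes F \<and> v \<in> fnodes F"
    and "fils F u v \<Longrightarrow> u \<in> fnodes F \<and> v \<in> fnodes F" by auto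
qed

theorem is_dual_dual:
  assumes "ordered_tree T"
  shows "is_dual T (dual T)"
proof (cases T)
  case (Node r F)
  have "fdistinct F" and r: "r \<notin> fnodes F"
    using assms unfolding Node ordered_tree_def by (auto simp: set_preorder)
  then have "ordered_tree (dual T)"
    using fdistinct_dual_forest[of F] fnodes_dual_forest[of F]
    unfolding Node dual_def ordered_tree_def by (auto simp: set_preorder)
  moreover have "nodes (dual T) = nodes T"
    using fnodes_dual_forest[of F] unfolding Node dual_def by simp
  moreover have "\<not> frmc F r v" "\<not> fils F r v" for v
    using r frmc_in[of F r v] fils_in[of F r v] by blast+
  ultimately show ?thesis
    using root_last_dual_forest[of F]
    unfolding Node is_dual_def dual_def
    by (auto simp: is_rmc_Node is_ils_Node dual_forest_fils_frmc)
qed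

text \<open>Uniqueness: a forest is determined by its last root, its vertex set, and the relations
  \<open>frmc\<close> and \<open>fils\<close>. In the induction, \<open>A\<close> is an ambient forest containing \<open>G\<close> as an
  initial segment of a list of siblings.\<close>

inductive sibs :: "'a otree list \<Rightarrow> 'a otree list \<Rightarrow> bool" for A where
  sibs_refl: "sibs A A"
| sibs_left: "sibs A (ts @ [t]) \<Longrightarrow> sibs A ts"
| sibs_down: "sibs A (ts @ [Node v cs]) \<Longrightarrow> sibs A cs"

lemma sibs_props:
  assumes "sibs A G" "fdistinct A"
  shows "fdistinct G \<and> fnodes G \<subseteq> fnodes A \<and>
    (\<forall>x\<in>fnodes G. \<forall>y. frmc A x y \<longrightarrow> frmc G x y) \<and>
    (\<forall>x\<in>fnodes G. \<forall>y. fils A x y \<longrightarrow> fils G x y)"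
  using assms
proof (induction rule: sibs.induct)
  case (sibs_left ts t)
  obtain v cs where t: "t = Node v cs" by (cases t)
  have eq: "fnodes (ts @ [Node v cs]) = insert v (fnodes ts \<union> fnodes cs)" by auto
  have IH: "fdistinct (ts @ [Node v cs])" "fnodes (ts @ [Node v cs]) \<subseteq> fnodes A"
    "\<And>x y. x \<in> fnodes (ts @ [Node v cs]) \<Longrightarrow> frmc A x y \<Longrightarrow> frmc (ts @ [Node v cs]) x y"
    "\<And>x y. x \<in> fnodes (ts @ [Node v cs]) \<Longrightarrow> fils A x y \<Longrightarrow> fils (ts @ [Node v cs]) x y"
    using sibs_left.IH[OF sibs_left.prems, unfolded t] by blast+
  have d: "fdistinct ts" "v \<notin> fnodes ts" "fnodes ts \<inter> fnodes cs = {}"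
    using IH(1) unfolding fdistinct_snoc by simp_all
  have sub: "fnodes ts \<subseteq> fnodes A" using IH(2) unfolding eq by blast
  have "frmc ts x y" if "x \<in> fnodes ts" "frmc A x y" for x y
  proof -
    have "x \<noteq> v" "x \<notin> fnodes cs" using that(1) d(2,3) by blast+
    moreover have "frmc (ts @ [Node v cs]) x y" using IH(3)[of x y] that unfolding eq by blast
    ultimately show ?thesis using frmc_in[of cs x y] unfolding frmc_snoc by blast
  qed
  moreover have "fils ts x y" if "x \<in> fnodes ts" "fils A x y" for x y
  proof -
    have "x \<noteq> v" "x \<notin> fnodes cs" using that(1) d(2,3) by blast+
    moreover have "fils (ts @ [Node v cs]) x y" using IH(4)[of x y] that unfolding eq by blast
    ultimately show ?thesis using fils_in[of cs x y] unfolding fils_snoc by blast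
  qed
  ultimately show ?case using d(1) sub by blast
next
  case (sibs_down ts v cs)
  have eq: "fnodes (ts @ [Node v cs]) = insert v (fnodes ts \<union> fnodes cs)" by auto
  have IH: "fdistinct (ts @ [Node v cs])" "fnodes (ts @ [Node v cs]) \<subseteq> fnodes A"
    "\<And>x y. x \<in> fnodes (ts @ [Node v cs]) \<Longrightarrow> frmc A x y \<Longrightarrow> frmc (ts @ [Node v cs]) x y"
    "\<And>x y. x \<in> fnodes (ts @ [Node v cs]) \<Longrightarrow> fils A x y \<Longrightarrow> fils (ts @ [Node v cs]) x y"
    using sibs_down.IH[OF sibs_down.prems] by blast+
  have d: "fdistinct cs" "v \<notin> fnodes cs" "fnodes ts \<inter> fnodes cs = {}"
    using IH(1) unfolding fdistinct_snoc by simp_all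
  have sub: "fnodes cs \<subseteq> fnodes A" using IH(2) unfolding eq by blast
  have "frmc cs x y" if "x \<in> fnodes cs" "frmc A x y" for x y
  proof -
    have "x \<noteq> v" "x \<notin> fnodes ts" using that(1) d(2,3) by blast+
    moreover have "frmc (ts @ [Node v cs]) x y" using IH(3)[of x y] that unfolding eq by blast
    ultimately show ?thesis using frmc_in[of ts x y] unfolding frmc_snoc by blast
  qed
  moreover have "fils cs x y" if "x \<in> fnodes cs" "fils A x y" for x y
  proof -
    have "x \<noteq> v" "x \<notin> fnodes ts" using that(1) d(2,3) by blast+
    moreover have "fils (ts @ [Node v cs]) x y" using IH(4)[of x y] that unfolding eq by blast
    ultimately show ?thesis using fils_in[of ts x y] unfolding fils_snoc by blast
  qed
  ultimately show ?case using d(1) sub by blast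
qed simp

lemma disjoint_insert_Un_eqD:
  assumes "A \<subseteq> A'" "B \<subseteq> B'" "v \<notin> A'" "v \<notin> B'" "A' \<inter> B' = {}"
    and "insert v (A \<union> B) = insert v (A' \<union> B')"
  shows "A = A' \<and> B = B'"
proof -
  have "x \<in> A" if "x \<in> A'" for x using that assms by auto
  moreover have "x \<in> B" if "x \<in> B'" for x using that assms by auto
  ultimately show ?thesis using assms(1,2) by auto
qed

lemma forest_unique_aux:
  assumes "fdistinct A" "sibs A G"
    and "F \<noteq> [] \<longrightarrow> G \<noteq> [] \<and> root (last G) = root (last F)"
    and "\<And>x y. frmc F x y \<Longrightarrow> frmc A x y" "\<And>x y. fils F x y \<Longrightarrow> fils A x y"
  shows "fnodes F \<subseteq> fnodes G \<and> (fnodes F = fnodes G \<longrightarrow> F = G)"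
  using assms(2-)
proof (induction F arbitrary: G rule: forest_induct)
  case Nil
  show ?case
  proof (cases G)
    case (Cons t us)
    then have "root t \<in> fnodes G" using otree.set_sel(1)[of t] by auto
    then show ?thesis by auto
  qed simp
next
  case (snoc ts v cs)
  obtain ts' cs' where G: "G = ts' @ [Node v cs']"
    using snoc.prems(2) by (cases G rule: dual_forest.cases) auto
  have sib: "sibs A ts'" "sibs A cs'"
    using sibs_left[OF snoc.prems(1)[unfolded G]] sibs_down[OF snoc.prems(1)[unfolded G]] .
  have eq: "fnodes (ts @ [Node v cs]) = insert v (fnodes ts \<union> fnodes cs)" for ts cs
    by auto
  have d: "fdistinct (ts' @ [Node v cs'])"
    using sibs_props[OF snoc.prems(1) assms(1)] unfolding G by (rule conjunct1)
  have 3: "v \<notin> fnodes ts'" "v \<notin> fnodes cs'" "fnodes ts' \<inter> fnodes cs' = {}"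
    using d unfolding fdistinct_snoc by simp_all
  have vG: "v \<in> fnodes G" unfolding G by simp
  note G_props = sibs_props[OF snoc.prems(1) assms(1), THEN conjunct2, THEN conjunct2]
  note G_rel = G_props[THEN conjunct1, THEN bspec, OF vG, rule_format]
    G_props[THEN conjunct2, THEN bspec, OF vG, rule_format]
  have rmc: "cs' \<noteq> [] \<and> root (last cs') = root (last cs)" if "cs \<noteq> []"
  proof -
    have "frmc (ts @ [Node v cs]) v (root (last cs))" unfolding frmc_snoc using that by blast
    then have "frmc G v (root (last cs))" by (intro G_rel(1) snoc.prems(3))
    moreover have "\<not> frmc ts' v y" "\<not> frmc cs' v y" for y
      using 3 frmc_in[of ts' v y] frmc_in[of cs' v y] by blast+
    ultimately show ?thesis unfolding G frmc_snoc by simp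
  qed
  have ils: "ts' \<noteq> [] \<and> root (last ts') = root (last ts)" if "ts \<noteq> []"
  proof -
    have "fils (ts @ [Node v cs]) v (root (last ts))" unfolding fils_snoc using that by blast
    then have "fils G v (root (last ts))" by (intro G_rel(2) snoc.prems(4))
    moreover have "\<not> fils ts' v y" "\<not> fils cs' v y" for y
      using 3 fils_in[of ts' v y] fils_in[of cs' v y] by blast+
    ultimately show ?thesis unfolding G fils_snoc by simp
  qed
  have prems': "frmc ts x y \<Longrightarrow> frmc A x y" "fils ts x y \<Longrightarrow> fils A x y"
    "frmc cs x y \<Longrightarrow> frmc A x y" "fils cs x y \<Longrightarrow> fils A x y" for x y
    by (simp_all add: snoc.prems(3,4) frmc_snoc fils_snoc)
  have 1: "fnodes ts \<subseteq> fnodes ts' \<and> (fnodes ts = fnodes ts' \<longrightarrow> ts = ts')"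
    using snoc.IH(1)[OF sib(1) _ prems'(1,2)] ils by simp
  have 2: "fnodes cs \<subseteq> fnodes cs' \<and> (fnodes cs = fnodes cs' \<longrightarrow> cs = cs')"
    using snoc.IH(2)[OF sib(2) _ prems'(3,4)] rmc by simp
  show ?case
  proof
    show "fnodes (ts @ [Node v cs]) \<subseteq> fnodes G" unfolding G eq
      by (intro insert_mono Un_mono conjunct1[OF 1] conjunct1[OF 2])
    show "fnodes (ts @ [Node v cs]) = fnodes G \<longrightarrow> ts @ [Node v cs] = G"
    proof
      assume "fnodes (ts @ [Node v cs]) = fnodes G"
      then have "insert v (fnodes ts \<union> fnodes cs) = insert v (fnodes ts' \<union> fnodes cs')"
        unfolding G eq .
      then have "fnodes ts = fnodes ts' \<and> fnodes cs = fnodes cs'"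
        by (rule disjoint_insert_Un_eqD[OF conjunct1[OF 1] conjunct1[OF 2] 3])
      then show "ts @ [Node v cs] = G" unfolding G using 1 2 by simp
    qed
  qed
qed

theorem is_dual_unique:
  assumes "ordered_tree T" "is_dual T D"
  shows "D = dual T"
proof -
  obtain r F where T: "T = Node r F" by (cases T)
  have D': "root D = r" using assms(2) by (simp add: is_dual_def T)
  then obtain G where D: "D = Node r G" by (cases D) auto
  have dG: "fdistinct G" and rG: "r \<notin> fnodes G" and rF: "r \<notin> fnodes F"
    using assms unfolding T D is_dual_def ordered_tree_def by (auto simp: set_preorder)
  have "nodes D = nodes T" using assms(2) by (simp add: is_dual_def)
  then have n: "fnodes F = fnodes (dual_forest G)"
    using rG rF unfolding fnodes_dual_forest T D by auto
  have last: "F \<noteq> [] \<longrightarrow> dual_forest G \<noteq> [] \<and> root (last (dual_forest G)) = root (last F)"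
  proof
    assume "F \<noteq> []"
    then have "is_rmc D r (root (last F))"
      using assms(2) by (auto simp: is_dual_def T is_rmc_Node)
    then have "G \<noteq> [] \<and> root (last G) = root (last F)"
      using rG frmc_in[of G r] by (auto simp: D is_rmc_Node)
    then show "dual_forest G \<noteq> [] \<and> root (last (dual_forest G)) = root (last F)"
      using root_last_dual_forest[of G] by simp
  qed
  have rmc: "frmc (dual_forest G) x y" if "frmc F x y" for x y
  proof -
    have "x \<noteq> r" using frmc_in[OF that] rF by blast
    then have "is_ils D x y" using assms(2) that by (auto simp: is_dual_def T is_rmc_Node)
    then have "fils G x y" by (simp add: D is_ils_Node)
    then show ?thesis by (simp add: dual_forest_fils_frmc)
  qed
  have ils: "fils (dual_forest G) x y" if "fils F x y" for x y
  proof -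
    have "x \<noteq> r" using fils_in[OF that] rF by blast
    moreover have "is_rmc D x y" using assms(2) that by (auto simp: is_dual_def T is_ils_Node)
    ultimately have "frmc G x y" by (simp add: D is_rmc_Node)
    then show ?thesis by (simp add: dual_forest_fils_frmc)
  qed
  have "F = dual_forest G"
    using forest_unique_aux[OF fdistinct_dual_forest[OF dG] sibs_refl last rmc ils] n by blast
  then show ?thesis by (simp add: dual_def T D dual_forest_dual_forest)
qed

theorem is_dual_iff: "ordered_tree T \<Longrightarrow> is_dual T D \<longleftrightarrow> D = dual T"
  using is_dual_dual is_dual_unique by blast

theorem ex1_dual: "ordered_tree T \<Longrightarrow> \<exists>!D. is_dual T D"
  using is_dual_dual is_dual_unique by blast

end

theory Submission
  imports Defs
begin

text \<open>Induct on a forest \<open>ts @ [Node x cs]\<close>, whose preorder is that of \<open>ts\<close>, then \<open>x\<close>, then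
  that of \<open>cs\<close>. In the forest the descendants of \<open>x\<close> are \<open>x\<close> and the nodes of \<open>cs\<close>; in the dual
  forest they are \<open>x\<close> and the nodes of \<open>ts\<close>. If \<open>v\<^sub>1\<close> and \<open>v\<^sub>2\<close> lie both in \<open>ts\<close> or both in
  \<open>cs\<close>, the induction hypothesis applies and \<open>x\<close> is no further candidate; otherwise \<open>v\<^sub>1\<close> lies in
  \<open>ts\<close> or is \<open>x\<close>, \<open>v\<^sub>2\<close> is \<open>x\<close> or lies in \<open>cs\<close>, and \<open>x\<close> is the only candidate.\<close>

text \<open>The relation behind \<open>dft_le\<close>, freed from the tree so that it can be split
  along the pieces of the preorder of a forest.\<close>

definition list_le :: "'a list \<Rightarrow> 'a \<Rightarrow> 'a \<Rightarrow> bool" where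
  "list_le L u v \<longleftrightarrow> (\<exists>i j. i \<le> j \<and> j < length L \<and> L ! i = u \<and> L ! j = v)"

lemma list_le_Nil [simp]: "\<not> list_le [] u v"
  by (simp add: list_le_def)

lemma list_le_Cons [simp]:
  "list_le (a # L) u v \<longleftrightarrow> (u = a \<and> v \<in> set (a # L)) \<or> list_le L u v" (is "?l \<longleftrightarrow> ?r")
proof
  assume ?l
  then obtain i j where *: "i \<le> j" "j < length (a # L)" "(a # L) ! i = u" "(a # L) ! j = v"
    unfolding list_le_def by blast
  show ?r
  proof (cases i)
    case 0
    with * show ?thesis by (metis nth_Cons_0 nth_mem)
  next
    case (Suc k)
    with * obtain l where "j = Suc l" by (cases j) auto
    with * Suc show ?thesis unfolding list_le_def by auto
  qed
next
  assume ?r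
  then show ?l
  proof
    assume *: "u = a \<and> v \<in> set (a # L)"
    then obtain j where "j < length (a # L)" "(a # L) ! j = v" by (metis in_set_conv_nth)
    with * show ?l unfolding list_le_def by (intro exI[of _ 0] exI[of _ j]) auto
  next
    assume "list_le L u v"
    then obtain i j where "i \<le> j" "j < length L" "L ! i = u" "L ! j = v"
      unfolding list_le_def by blast
    then show ?l unfolding list_le_def by (intro exI[of _ "Suc i"] exI[of _ "Suc j"]) auto
  qed
qed

lemma list_le_append:
  "list_le (xs @ ys) u v \<longleftrightarrow> list_le xs u v \<or> list_le ys u v \<or> (u \<in> set xs \<and> v \<in> set ys)"
  by (induction xs) auto

lemma list_le_in: "list_le L u v \<Longrightarrow> u \<in> set L \<and> v \<in> set L"
  by (induction L) auto

text \<open>Deleting \<open>r\<close> from \<open>T\<close> and from its dual leaves two forests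
  exchanged by \<open>dual_forest\<close>; the induction runs on these.\<close>

definition fsubtree_at :: "'a otree list \<Rightarrow> 'a \<Rightarrow> 'a set" where
  "fsubtree_at F v = (\<Union>t\<in>set F. subtree_at t v)"

lemma fsubtree_at_Nil [simp]: "fsubtree_at [] v = {}"
  by (simp add: fsubtree_at_def)

lemma subtree_at_Node:
  "subtree_at (Node a F) v = (if v = a then nodes (Node a F) else {}) \<union> fsubtree_at F v"
proof -
  have "w \<in> subtree_at T v \<longleftrightarrow> (\<exists>S\<in>subtrees T. root S = v \<and> w \<in> nodes S)" for T and w :: 'a
    unfolding subtree_at_def by blast
  then show ?thesis unfolding fsubtree_at_def by (intro set_eqI) auto
qed

lemma fsubtree_at_snoc:
  "fsubtree_at (ts @ [Node x cs]) v =
     fsubtree_at ts v \<union> fsubtree_at cs v \<union> (if v = x then insert x (fnodes cs) else {})"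
proof -
  have "fsubtree_at (ts @ [Node x cs]) v = fsubtree_at ts v \<union> subtree_at (Node x cs) v"
    unfolding fsubtree_at_def by auto
  then show ?thesis unfolding subtree_at_Node by auto
qed

lemma fsubtree_at_in: "w \<in> fsubtree_at F v \<Longrightarrow> v \<in> fnodes F \<and> w \<in> fnodes F"
proof (induction F rule: forest_induct)
  case (snoc ts x cs)
  then show ?case unfolding fsubtree_at_snoc by (auto split: if_splits)
qed simp

theorem ex1_dual_forest_ancestor:
  assumes "fdistinct F" and "list_le (concat (map preorder F)) v1 v2"
  shows "\<exists>!v. v1 \<in> fsubtree_at (dual_forest F) v \<and> v2 \<in> fsubtree_at F v"
  using assms
proof (induction F rule: forest_induct)
  case (snoc ts x cs)
  \<comment> \<open>Naming these sets keeps automation from unfolding the unions behind \<open>fnodes\<close>.\<close>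
  define A B where "A = fnodes ts" and "B = fnodes cs"
  have d: "fdistinct ts" "fdistinct cs" "x \<notin> A" "x \<notin> B" "A \<inter> B = {}"
    using snoc.prems(1) unfolding fdistinct_snoc A_def B_def by simp_all
  have set_A: "set (concat (map preorder ts)) = A" and set_B: "set (concat (map preorder cs)) = B"
    unfolding A_def B_def by (simp_all add: set_preorder)
  have in_A: "v \<in> A \<and> w \<in> A" if "w \<in> fsubtree_at ts v \<or> w \<in> fsubtree_at (dual_forest ts) v"
    for v w
    using that fsubtree_at_in[of w ts v] fsubtree_at_in[of w "dual_forest ts" v]
    unfolding fnodes_dual_forest A_def[symmetric] by blast
  have in_B: "v \<in> B \<and> w \<in> B" if "w \<in> fsubtree_at cs v \<or> w \<in> fsubtree_at (dual_forest cs) v"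
    for v w
    using that fsubtree_at_in[of w cs v] fsubtree_at_in[of w "dual_forest cs" v]
    unfolding fnodes_dual_forest B_def[symmetric] by blast
  \<comment> \<open>\<open>dual_forest\<close> swaps \<open>ts\<close> and \<open>cs\<close>: in the
    dual, \<open>x\<close> sits above the dual of \<open>ts\<close>. Hence \<open>A\<close> for
    \<open>v1\<close> but \<open>B\<close> for \<open>v2\<close>.\<close>
  have candidate: "v1 \<in> fsubtree_at (dual_forest (ts @ [Node x cs])) v \<and>
        v2 \<in> fsubtree_at (ts @ [Node x cs]) v \<longleftrightarrow>
      (v1 \<in> fsubtree_at (dual_forest ts) v \<or> v1 \<in> fsubtree_at (dual_forest cs) v \<or>
        v = x \<and> v1 \<in> insert x A) \<and>
      (v2 \<in> fsubtree_at ts v \<or> v2 \<in> fsubtree_at cs v \<or> v = x \<and> v2 \<in> insert x B)" for v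
    unfolding dual_forest.simps fsubtree_at_snoc fnodes_dual_forest
      A_def[symmetric] B_def[symmetric] by auto
  have "list_le (concat (map preorder ts) @ x # concat (map preorder cs)) v1 v2"
    using snoc.prems(2) by simp
  then consider (left) "list_le (concat (map preorder ts)) v1 v2"
    | (below) "list_le (concat (map preorder cs)) v1 v2"
    | (mixed) "v1 \<in> insert x A" "v2 \<in> insert x B"
    unfolding list_le_append list_le_Cons list.set set_A set_B by blast
  then show ?case
  proof cases
    case left
    have "v1 \<in> A" "v2 \<in> A"
      using list_le_in[OF left] unfolding set_A by simp_all
    \<comment> \<open>Here \<open>x\<close> fails through \<open>v2\<close>, which is in
      \<open>A\<close> and hence not in \<open>insert x B\<close>.\<close>
    then have "v1 \<in> fsubtree_at (dual_forest (ts @ [Node x cs])) v \<and>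
        v2 \<in> fsubtree_at (ts @ [Node x cs]) v \<longleftrightarrow>
        v1 \<in> fsubtree_at (dual_forest ts) v \<and> v2 \<in> fsubtree_at ts v" for v
      unfolding candidate using d(3-5) in_A in_B by blast
    then show ?thesis using snoc.IH(1)[OF d(1) left] by simp
  next
    case below
    have "v1 \<in> B" "v2 \<in> B"
      using list_le_in[OF below] unfolding set_B by simp_all
    \<comment> \<open>Here \<open>x\<close> fails through \<open>v1\<close>, which is in
      \<open>B\<close> and hence not in \<open>insert x A\<close>.\<close>
    then have "v1 \<in> fsubtree_at (dual_forest (ts @ [Node x cs])) v \<and>
        v2 \<in> fsubtree_at (ts @ [Node x cs]) v \<longleftrightarrow>
        v1 \<in> fsubtree_at (dual_forest cs) v \<and> v2 \<in> fsubtree_at cs v" for v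
      unfolding candidate using d(3-5) in_A in_B by blast
    then show ?thesis using snoc.IH(2)[OF d(2) below] by simp
  next
    case mixed
    \<comment> \<open>A candidate other than \<open>x\<close> would lie in \<open>A\<close> because
      of \<open>v1\<close> and in \<open>B\<close> because of \<open>v2\<close>, but these are
      disjoint.\<close>
    then have "v1 \<in> fsubtree_at (dual_forest (ts @ [Node x cs])) v \<and>
        v2 \<in> fsubtree_at (ts @ [Node x cs]) v \<longleftrightarrow> v = x" for v
      unfolding candidate using d(3-5) in_A in_B by blast
    then show ?thesis by simp
  qed
qed simp

theorem theorem5:
  fixes T T_dual :: "'a otree" and r v1 v2 :: 'a
  assumes "ordered_tree T"
    and "r = root T"
    and "is_dual T T_dual"
    and "v1 \<in> nodes T - {r}"
    and "v2 \<in> nodes T - {r}"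
    and "dft_le T v1 v2"
  shows "\<exists>!v. v \<in> nodes T - {r} \<and> v1 \<in> subtree_at T_dual v \<and> v2 \<in> subtree_at T v"
proof -
  obtain F where T: "T = Node r F" using assms(2) by (cases T) auto
  have D: "T_dual = Node r (dual_forest F)"
    using is_dual_unique[OF assms(1,3)] by (simp add: dual_def T)
  have F: "fdistinct F" "r \<notin> fnodes F"
    using assms(1) unfolding T ordered_tree_def by (auto simp: set_preorder)
  have "list_le (preorder T) v1 v2"
    using assms(6) unfolding dft_le_def list_le_def .
  \<comment> \<open>As \<open>v1\<close> is not \<open>r\<close>, the head of the preorder drops
    out.\<close>
  then have "list_le (concat (map preorder F)) v1 v2"
    using assms(4) unfolding T by auto
  note ex1 = ex1_dual_forest_ancestor[OF F(1) this]
  \<comment> \<open>On the right \<open>v\<close> differs from \<open>r\<close> automatically: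
    \<open>fsubtree_at F v\<close> is nonempty only for nodes of \<open>F\<close>.\<close>
  have "v \<in> nodes T - {r} \<and> v1 \<in> subtree_at T_dual v \<and> v2 \<in> subtree_at T v \<longleftrightarrow>
      v1 \<in> fsubtree_at (dual_forest F) v \<and> v2 \<in> fsubtree_at F v" for v
    using F(2) fsubtree_at_in[of v2 F v] unfolding T D subtree_at_Node by auto
  then show ?thesis using ex1 by simp
qed

end
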